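(* Let $k$ be a field of characteristic $0$, let $H$ be a Hopf algebra over $k$ and let $\mathcal B$ be a $\Phi$-set theoretic basis of $H$. Suppose that $\mathcal B$ satisfies positivity with respect to the unit and counit, i.e. $\varepsilon(b)\ge0$ for all $b\in\mathcal B$, and $\lambda_c\ge0$ for all $c\in\mathcal B$ in the decomposition $1_H=\sum_{c\in\mathcal B}\lambda_c c$. Then $H$ has the nearly positive basis property.
   Context: For a Hopf algebra $H$ put $\Phi_H(x\otimes y)=x_{(1)}\otimes x_{(2)}y$. A basis $\mathcal B$ of $H$ is $\Phi$-set theoretic if for all $b,c\in\mathcal B$ there are $b',c'\in\mathcal B$ with $\Phi_H(b\otimes c)=b'\otimes c'$. $H$ has the nearly positive basis property if it has a basis $B$ such that the following are all nonnegative: the coordinates of $1_H$ in $B$; the values $\varepsilon(b)$, $b\in B$; the coordinates of $b_1b_2$ in $B$ for $b_1,b_2\in B$; the coordinates of $\Delta(b)$ in $B\otimes B$ for $b\in B$ (no condition is imposed on the antipode). Nonnegativity of scalars is understood by viewing $k$ as a subfield of $\mathbb C$. *)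

theory Defs
  imports Complex_Main "HOL-Library.Poly_Mapping" "HOL-Library.Nonpos_Ints"
begin

section \<open>Tensor products\<close>

text \<open>
  The scalar multiplication is an explicit argument, as in the locale
  \<^locale>\<open>vector_space\<close>, because the field is an arbitrary type.  Therefore the tensor product
  of \<open>H\<close> with itself cannot be a type constructor.  It is presented in the textbook way, as the
  free vector space on \<open>H \<times> H\<close> modulo the bilinear relations: elements of \<open>H \<otimes> H\<close> are written
  as formal linear combinations in \<open>(H \<times> H) \<Rightarrow>\<^sub>0 k\<close>, and equality in \<open>H \<otimes> H\<close> is the congruence
  \<open>tensor_eq\<close>.  A map into \<open>H \<otimes> H\<close> is given by a choice of representatives, and all
  statements below are invariant under \<open>tensor_eq\<close>.
\<close>

abbreviation gen :: "'i \<Rightarrow> ('i \<Rightarrow>\<^sub>0 'k::field)" where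
  "gen i \<equiv> Poly_Mapping.single i 1"

definition fscale :: "'k::field \<Rightarrow> ('i \<Rightarrow>\<^sub>0 'k) \<Rightarrow> ('i \<Rightarrow>\<^sub>0 'k)" where
  "fscale c u = Poly_Mapping.map ((*) c) u"

text \<open>The linear extension of a function on the generators of a free vector space.\<close>

definition lin_ext ::
    "('k::field \<Rightarrow> 'v::ab_group_add \<Rightarrow> 'v) \<Rightarrow> ('i \<Rightarrow> 'v) \<Rightarrow> ('i \<Rightarrow>\<^sub>0 'k) \<Rightarrow> 'v" where
  "lin_ext s f u = (\<Sum>i\<in>Poly_Mapping.keys u. s (Poly_Mapping.lookup u i) (f i))"

definition bilinear_relations ::
    "('k::field \<Rightarrow> 'h::ab_group_add \<Rightarrow> 'h) \<Rightarrow> (('h \<times> 'h) \<Rightarrow>\<^sub>0 'k) set" where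
  "bilinear_relations s =
     {gen (x + x', y) - gen (x, y) - gen (x', y) | x x' y. True} \<union>
     {gen (x, y + y') - gen (x, y) - gen (x, y') | x y y'. True} \<union>
     {gen (s a x, y) - fscale a (gen (x, y)) | a x y. True} \<union>
     {gen (x, s a y) - fscale a (gen (x, y)) | a x y. True}"

definition trilinear_relations ::
    "('k::field \<Rightarrow> 'h::ab_group_add \<Rightarrow> 'h) \<Rightarrow> (('h \<times> 'h \<times> 'h) \<Rightarrow>\<^sub>0 'k) set" where
  "trilinear_relations s =
     {gen (x + x', y, z) - gen (x, y, z) - gen (x', y, z) | x x' y z. True} \<union>
     {gen (x, y + y', z) - gen (x, y, z) - gen (x, y', z) | x y y' z. True} \<union>
     {gen (x, y, z + z') - gen (x, y, z) - gen (x, y, z') | x y z z'. True} \<union>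
     {gen (s a x, y, z) - fscale a (gen (x, y, z)) | a x y z. True} \<union>
     {gen (x, s a y, z) - fscale a (gen (x, y, z)) | a x y z. True} \<union>
     {gen (x, y, s a z) - fscale a (gen (x, y, z)) | a x y z. True}"

definition tensor_eq ::
    "('k::field \<Rightarrow> 'h::ab_group_add \<Rightarrow> 'h) \<Rightarrow> (('h \<times> 'h) \<Rightarrow>\<^sub>0 'k) \<Rightarrow> (('h \<times> 'h) \<Rightarrow>\<^sub>0 'k) \<Rightarrow> bool" where
  "tensor_eq s u v \<longleftrightarrow> u - v \<in> module.span fscale (bilinear_relations s)"

definition tensor3_eq ::
    "('k::field \<Rightarrow> 'h::ab_group_add \<Rightarrow> 'h) \<Rightarrow>
     (('h \<times> 'h \<times> 'h) \<Rightarrow>\<^sub>0 'k) \<Rightarrow> (('h \<times> 'h \<times> 'h) \<Rightarrow>\<^sub>0 'k) \<Rightarrow> bool" where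
  "tensor3_eq s u v \<longleftrightarrow> u - v \<in> module.span fscale (trilinear_relations s)"

text \<open>The product \<open>(x \<otimes> y)(x' \<otimes> y') = xx' \<otimes> yy'\<close> of \<open>H \<otimes> H\<close>.\<close>

definition tensor_mult ::
    "(('h::ring_1 \<times> 'h) \<Rightarrow>\<^sub>0 'k::field) \<Rightarrow> (('h \<times> 'h) \<Rightarrow>\<^sub>0 'k) \<Rightarrow> (('h \<times> 'h) \<Rightarrow>\<^sub>0 'k)" where
  "tensor_mult u v =
     lin_ext fscale (\<lambda>(x, y). lin_ext fscale (\<lambda>(x', y'). gen (x * x', y * y')) v) u"

definition is_basis :: "('k::field \<Rightarrow> 'h::ab_group_add \<Rightarrow> 'h) \<Rightarrow> 'h set \<Rightarrow> bool" where
  "is_basis s B \<longleftrightarrow> \<not> module.dependent s B \<and> module.span s B = UNIV"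

text \<open>
  The coordinates of an element of \<open>H \<otimes> H\<close> in \<open>B \<otimes> B = {b \<otimes> c | b, c \<in> B}\<close>: a formal
  combination supported on \<open>B \<times> B\<close> is an expansion in \<open>B \<otimes> B\<close>.  Lemma \<open>tensor_coords_ex1\<close>
  below shows that the description is proper when \<open>B\<close> is a basis.
\<close>

definition tensor_coords ::
    "('k::field \<Rightarrow> 'h::ab_group_add \<Rightarrow> 'h) \<Rightarrow> 'h set \<Rightarrow> (('h \<times> 'h) \<Rightarrow>\<^sub>0 'k) \<Rightarrow> (('h \<times> 'h) \<Rightarrow>\<^sub>0 'k)" where
  "tensor_coords s B u = (THE a. Poly_Mapping.keys a \<subseteq> B \<times> B \<and> tensor_eq s u a)"


section \<open>Hopf algebras\<close>

text \<open>
  The comultiplication is given by representatives in the free vector space on \<open>H \<times> H\<close>, hence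
  linear, coassociative and multiplicative only up to the tensor congruences.  For
  \<open>\<Delta>(h) = \<Sum> x \<otimes> y\<close>, the two sides of coassociativity are \<open>\<Sum> \<Delta>(x) \<otimes> y\<close> and \<open>\<Sum> x \<otimes> \<Delta>(y)\<close>.
\<close>

locale hopf_algebra = vector_space scale
  for scale :: "'k::field \<Rightarrow> 'h::ring_1 \<Rightarrow> 'h" +
  fixes comult :: "'h \<Rightarrow> (('h \<times> 'h) \<Rightarrow>\<^sub>0 'k)"
    and counit :: "'h \<Rightarrow> 'k"
    and antipode :: "'h \<Rightarrow> 'h"
  assumes mult_scale_left: "scale a x * y = scale a (x * y)"
    and mult_scale_right: "x * scale a y = scale a (x * y)"
    and comult_add: "tensor_eq scale (comult (x + y)) (comult x + comult y)"
    and comult_scale: "tensor_eq scale (comult (scale a x)) (fscale a (comult x))"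
    and coassoc: "tensor3_eq scale
       (lin_ext fscale (\<lambda>(x, y). lin_ext fscale (\<lambda>(p, q). gen (p, q, y)) (comult x)) (comult h))
       (lin_ext fscale (\<lambda>(x, y). lin_ext fscale (\<lambda>(p, q). gen (x, p, q)) (comult y)) (comult h))"
    and linear_counit: "Vector_Spaces.linear scale (*) counit"
    and counit_left: "lin_ext scale (\<lambda>(x, y). scale (counit x) y) (comult h) = h"
    and counit_right: "lin_ext scale (\<lambda>(x, y). scale (counit y) x) (comult h) = h"
    and comult_one: "tensor_eq scale (comult 1) (gen (1, 1))"
    and comult_mult: "tensor_eq scale (comult (x * y)) (tensor_mult (comult x) (comult y))"
    and counit_one: "counit 1 = 1"
    and counit_mult: "counit (x * y) = counit x * counit y"
    and linear_antipode: "Vector_Spaces.linear scale scale antipode"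
    and antipode_left: "lin_ext scale (\<lambda>(x, y). antipode x * y) (comult h) = scale (counit h) 1"
    and antipode_right: "lin_ext scale (\<lambda>(x, y). x * antipode y) (comult h) = scale (counit h) 1"

text \<open>\<open>\<Phi>\<^sub>H(x \<otimes> y) = x\<^sub>(\<^sub>1\<^sub>) \<otimes> x\<^sub>(\<^sub>2\<^sub>) y\<close>\<close>

definition Phi ::
    "('h::ring_1 \<Rightarrow> (('h \<times> 'h) \<Rightarrow>\<^sub>0 'k::field)) \<Rightarrow> (('h \<times> 'h) \<Rightarrow>\<^sub>0 'k) \<Rightarrow> (('h \<times> 'h) \<Rightarrow>\<^sub>0 'k)" where
  "Phi comult u =
     lin_ext fscale (\<lambda>(x, y). lin_ext fscale (\<lambda>(p, q). gen (p, q * y)) (comult x)) u"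

definition Phi_set_theoretic_basis ::
    "('k::field \<Rightarrow> 'h::ring_1 \<Rightarrow> 'h) \<Rightarrow> ('h \<Rightarrow> (('h \<times> 'h) \<Rightarrow>\<^sub>0 'k)) \<Rightarrow> 'h set \<Rightarrow> bool" where
  "Phi_set_theoretic_basis scale comult B \<longleftrightarrow> is_basis scale B \<and>
     (\<forall>b\<in>B. \<forall>c\<in>B. \<exists>b'\<in>B. \<exists>c'\<in>B. tensor_eq scale (Phi comult (gen (b, c))) (gen (b', c')))"


section \<open>Positivity\<close>

text \<open>A field viewed as a subfield of the complex numbers.\<close>

locale complex_embedding =
  fixes \<sigma> :: "'k::field \<Rightarrow> complex"
  assumes embed_one: "\<sigma> 1 = 1"
    and embed_add: "\<sigma> (x + y) = \<sigma> x + \<sigma> y"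
    and embed_mult: "\<sigma> (x * y) = \<sigma> x * \<sigma> y"

definition nonneg_scalar :: "('k::field \<Rightarrow> complex) \<Rightarrow> 'k \<Rightarrow> bool" where
  "nonneg_scalar \<sigma> a \<longleftrightarrow> \<sigma> a \<in> \<real>\<^sub>\<ge>\<^sub>0"

definition nearly_positive_basis_property ::
    "('k::field \<Rightarrow> complex) \<Rightarrow> ('k \<Rightarrow> 'h::ring_1 \<Rightarrow> 'h) \<Rightarrow> ('h \<Rightarrow> (('h \<times> 'h) \<Rightarrow>\<^sub>0 'k)) \<Rightarrow>
     ('h \<Rightarrow> 'k) \<Rightarrow> bool" where
  "nearly_positive_basis_property \<sigma> scale comult counit \<longleftrightarrow>
     (\<exists>B. is_basis scale B \<and>
       (\<forall>c\<in>B. nonneg_scalar \<sigma> (module.representation scale B 1 c)) \<and>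
       (\<forall>b\<in>B. nonneg_scalar \<sigma> (counit b)) \<and>
       (\<forall>b1\<in>B. \<forall>b2\<in>B. \<forall>c\<in>B. nonneg_scalar \<sigma> (module.representation scale B (b1 * b2) c)) \<and>
       (\<forall>b\<in>B. \<forall>c\<in>B. \<forall>d\<in>B.
          nonneg_scalar \<sigma> (Poly_Mapping.lookup (tensor_coords scale B (comult b)) (c, d))))"


section \<open>Coordinates in a tensor product are well defined\<close>

lemma lookup_fscale [simp]: "Poly_Mapping.lookup (fscale c u) i = c * Poly_Mapping.lookup u i"
  by (simp add: fscale_def Poly_Mapping.map.rep_eq when_def)

interpretation free: vector_space fscale
  by unfold_locales (auto intro!: poly_mapping_eqI simp: lookup_add algebra_simps)

lemma keys_fscale: "Poly_Mapping.keys (fscale c u) \<subseteq> Poly_Mapping.keys u"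
  by (auto simp: in_keys_iff)

lemma lin_ext_superset:
  assumes "vector_space s" "finite A" "Poly_Mapping.keys u \<subseteq> A"
  shows "lin_ext s f u = (\<Sum>i\<in>A. s (Poly_Mapping.lookup u i) (f i))"
proof -
  interpret vector_space s by fact
  show ?thesis
    unfolding lin_ext_def
    by (rule sum.mono_neutral_left) (use assms in \<open>auto simp: in_keys_iff\<close>)
qed

lemma linear_lin_ext:
  assumes "vector_space s"
  shows "Vector_Spaces.linear fscale s (lin_ext s f)"
proof -
  interpret vector_space s by fact
  show ?thesis
  proof unfold_locales
    fix u v :: "'c \<Rightarrow>\<^sub>0 'a" and a :: 'a
    let ?A = "Poly_Mapping.keys u \<union> Poly_Mapping.keys v"
    have A: "finite ?A" by simp
    show "lin_ext s f (u + v) = lin_ext s f u + lin_ext s f v"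
      using keys_add[of u v] lin_ext_superset[OF assms A]
      by (simp add: lookup_add scale_left_distrib sum.distrib)
    show "lin_ext s f (fscale a u) = s a (lin_ext s f u)"
      using keys_fscale[of a u] lin_ext_superset[OF assms finite_keys, where u = "fscale a u"]
      by (simp add: lin_ext_def scale_sum_right)
  qed
qed

lemma lin_ext_gen [simp]:
  assumes "vector_space s"
  shows "lin_ext s f (gen i) = f i"
proof -
  interpret vector_space s by fact
  show ?thesis by (simp add: lin_ext_def)
qed

lemma lin_ext_fscale_gen: "lin_ext fscale gen u = u"
proof (rule poly_mapping_eqI)
  fix j
  have "Poly_Mapping.lookup (lin_ext fscale gen u) j =
      (\<Sum>i\<in>Poly_Mapping.keys u. if i = j then Poly_Mapping.lookup u i else 0)"
    unfolding lin_ext_def lookup_sum by (rule sum.cong) (simp_all add: lookup_single when_def)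
  also have "\<dots> = Poly_Mapping.lookup u j"
    by (simp add: in_keys_iff)
  finally show "Poly_Mapping.lookup (lin_ext fscale gen u) j = Poly_Mapping.lookup u j" .
qed

lemma tensor_eq_refl: "tensor_eq s u u"
  by (simp add: tensor_eq_def free.span_zero)

lemma tensor_eq_sym: "tensor_eq s u v \<Longrightarrow> tensor_eq s v u"
  unfolding tensor_eq_def using free.span_neg[of "u - v"] by simp

lemma tensor_eq_trans: "tensor_eq s u v \<Longrightarrow> tensor_eq s v w \<Longrightarrow> tensor_eq s u w"
  unfolding tensor_eq_def using free.span_add[of "u - v" _ "v - w"] by simp

lemma tensor_eq_add:
  "tensor_eq s u v \<Longrightarrow> tensor_eq s u' v' \<Longrightarrow> tensor_eq s (u + u') (v + v')"
  unfolding tensor_eq_def using free.span_add[of "u - v" _ "u' - v'"] by (simp add: add_diff_add)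

lemma tensor_eq_scale: "tensor_eq s u v \<Longrightarrow> tensor_eq s (fscale a u) (fscale a v)"
  unfolding tensor_eq_def using free.span_scale[of "u - v" _ a] by (simp add: free.scale_right_diff_distrib)

text \<open>The universal property: a bilinear map factors through the tensor product.\<close>

lemma tensor_eq_lin_ext:
  assumes "vector_space t"
    and "\<And>x x' y. f (x + x', y) = f (x, y) + f (x', y)"
    and "\<And>x y y'. f (x, y + y') = f (x, y) + f (x, y')"
    and "\<And>a x y. f (s a x, y) = t a (f (x, y))"
    and "\<And>a x y. f (x, s a y) = t a (f (x, y))"
    and "tensor_eq s u v"
  shows "lin_ext t f u = lin_ext t f v"
proof -
  interpret L: Vector_Spaces.linear fscale t "lin_ext t f"
    by (rule linear_lin_ext) fact
  have "lin_ext t f w = 0" if "w \<in> free.span (bilinear_relations s)" for w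
    using that
  proof (induction rule: free.span_induct_alt)
    case base
    show ?case by (rule L.zero)
  next
    case (step c r w)
    have "lin_ext t f r = 0"
      using step.hyps unfolding bilinear_relations_def
      by (auto simp: L.diff L.scale lin_ext_gen[OF assms(1)] assms(2-5))
    then show ?case
      using step.IH by (simp add: L.add L.scale)
  qed
  from this[of "u - v"] assms(6) show ?thesis
    by (simp add: tensor_eq_def L.diff)
qed

lemma tensor_eq_relations:
  shows "tensor_eq s (gen (x + x', y)) (gen (x, y) + gen (x', y))"
    and "tensor_eq s (gen (x, y + y')) (gen (x, y) + gen (x, y'))"
    and "tensor_eq s (gen (s a x, y)) (fscale a (gen (x, y)))"
    and "tensor_eq s (gen (x, s a y)) (fscale a (gen (x, y)))"
  unfolding tensor_eq_def
  by (intro free.span_base; (unfold bilinear_relations_def diff_diff_eq[symmetric]); blast)+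

lemma tensor_coords_unique:
  assumes "vector_space s" "is_basis s B"
    and "Poly_Mapping.keys u \<subseteq> B \<times> B" "Poly_Mapping.keys v \<subseteq> B \<times> B" "tensor_eq s u v"
  shows "u = v"
proof -
  interpret vector_space s by fact
  have k: "vector_space ((*) :: 'a \<Rightarrow> 'a \<Rightarrow> 'a)"
    by unfold_locales (auto simp: algebra_simps)
  have ind: "independent B" and span: "\<And>x. x \<in> span B"
    using assms(2) by (auto simp: is_basis_def)
  define f where "f = (\<lambda>b c (x, y). representation B x b * representation B y c)"
  have eq: "lin_ext (*) (f b c) u = lin_ext (*) (f b c) v" for b c
    by (rule tensor_eq_lin_ext[OF k _ _ _ _ assms(5)])
      (auto simp: f_def representation_add[OF ind span span] representation_scale[OF ind span]
        algebra_simps)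
  have coord: "lin_ext (*) (f b c) w = Poly_Mapping.lookup w (b, c)"
    if "Poly_Mapping.keys w \<subseteq> B \<times> B" for b c w
  proof -
    have "lin_ext (*) (f b c) w =
        (\<Sum>i\<in>Poly_Mapping.keys w. if i = (b, c) then Poly_Mapping.lookup w i else 0)"
      unfolding lin_ext_def
    proof (rule sum.cong[OF refl])
      fix i assume "i \<in> Poly_Mapping.keys w"
      with that obtain x y where "i = (x, y)" "x \<in> B" "y \<in> B" by auto
      then show "Poly_Mapping.lookup w i * f b c i =
          (if i = (b, c) then Poly_Mapping.lookup w i else 0)"
        by (simp add: f_def representation_basis[OF ind])
    qed
    also have "\<dots> = Poly_Mapping.lookup w (b, c)"
      by (simp add: in_keys_iff)
    finally show ?thesis .
  qed
  show ?thesis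
  proof (rule poly_mapping_eqI)
    fix i :: "'b \<times> 'b"
    obtain b c where "i = (b, c)" by (cases i)
    with eq[of b c] coord[OF assms(3), of b c] coord[OF assms(4), of b c]
    show "Poly_Mapping.lookup u i = Poly_Mapping.lookup v i" by simp
  qed
qed

lemma tensor_coords_exist:
  assumes "vector_space s" "is_basis s B"
  shows "\<exists>a. Poly_Mapping.keys a \<subseteq> B \<times> B \<and> tensor_eq s u a"
proof -
  interpret vector_space s by fact
  have span: "\<And>x. x \<in> span B"
    using assms(2) by (auto simp: is_basis_def)
  define good where "good u \<longleftrightarrow> (\<exists>a. Poly_Mapping.keys a \<subseteq> B \<times> B \<and> tensor_eq s u a)" for u
  have good_zero: "good 0"
    unfolding good_def by (rule exI[of _ 0]) (simp add: tensor_eq_refl)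
  have good_add: "good (u + v)" if "good u" "good v" for u v
  proof -
    from that obtain a b where "Poly_Mapping.keys a \<subseteq> B \<times> B" "tensor_eq s u a"
      "Poly_Mapping.keys b \<subseteq> B \<times> B" "tensor_eq s v b"
      unfolding good_def by blast
    then show ?thesis
      unfolding good_def using keys_add[of a b] tensor_eq_add by (intro exI[of _ "a + b"]) blast
  qed
  have good_scale: "good (fscale a u)" if "good u" for a u
  proof -
    from that obtain b where "Poly_Mapping.keys b \<subseteq> B \<times> B" "tensor_eq s u b"
      unfolding good_def by blast
    then show ?thesis
      unfolding good_def using keys_fscale[of a b] tensor_eq_scale
      by (intro exI[of _ "fscale a b"]) blast
  qed
  have good_cong: "good u" if "tensor_eq s u v" "good v" for u v
    using that unfolding good_def by (meson tensor_eq_trans)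
  have good_basis: "good (gen (b, c))" if "b \<in> B" "c \<in> B" for b c
    unfolding good_def using that by (intro exI[of _ "gen (b, c)"]) (simp add: tensor_eq_refl)
  have zero_r: "good (gen (x, 0))" for x
    using good_cong[OF tensor_eq_relations(4)[of s x 0 0]] good_zero by simp
  have zero_l: "good (gen (0, y))" for y
    using good_cong[OF tensor_eq_relations(3)[of s 0 0 y]] good_zero by simp
  have right: "good (gen (b, y))" if "b \<in> B" for b y
    using span[of y]
  proof (induction rule: span_induct_alt)
    case base
    show ?case by (rule zero_r)
  next
    case (step c x y)
    have "good (gen (b, s c x))"
      using step.hyps by (intro good_cong[OF tensor_eq_relations(4)] good_scale good_basis[OF that])
    then show ?case
      using step.IH by (intro good_cong[OF tensor_eq_relations(2)] good_add)
  qed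
  have left: "good (gen (x, y))" for x y
    using span[of x]
  proof (induction rule: span_induct_alt)
    case base
    show ?case by (rule zero_l)
  next
    case (step c b x)
    have "good (gen (s c b, y))"
      using step.hyps by (intro good_cong[OF tensor_eq_relations(3)] good_scale right)
    then show ?case
      using step.IH by (intro good_cong[OF tensor_eq_relations(1)] good_add)
  qed
  have "good (\<Sum>i\<in>A. fscale (Poly_Mapping.lookup u i) (gen i))" if "finite A" for A
    using that
  proof (induction rule: finite_induct)
    case (insert i A)
    then show ?case using left[of "fst i" "snd i"] by (simp add: good_add good_scale)
  qed (simp add: good_zero)
  then have "good (lin_ext fscale gen u)"
    unfolding lin_ext_def by simp
  then show ?thesis
    by (simp add: lin_ext_fscale_gen good_def)
qed

lemma tensor_coords_ex1:
  assumes "vector_space s" "is_basis s B"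
  shows "\<exists>!a. Poly_Mapping.keys a \<subseteq> B \<times> B \<and> tensor_eq s u a"
proof (rule ex_ex1I)
  fix a b
  assume "Poly_Mapping.keys a \<subseteq> B \<times> B \<and> tensor_eq s u a"
    and "Poly_Mapping.keys b \<subseteq> B \<times> B \<and> tensor_eq s u b"
  then show "a = b"
    by (blast intro: tensor_coords_unique[OF assms] tensor_eq_trans tensor_eq_sym)
qed (rule tensor_coords_exist[OF assms])

end

theory Submission
  imports Defs
begin

text \<open>
  The basis \<open>\<B>\<close> itself is nearly positive.  If \<open>\<Phi>\<^sub>H(b \<otimes> c) = b' \<otimes> c'\<close>, then applying
  \<open>\<epsilon> \<otimes> id\<close> gives \<open>bc = \<epsilon>(b')c'\<close>, so the structure constants of the product are values of the
  counit.  Since \<open>\<Delta>(b) = \<Phi>\<^sub>H(b \<otimes> 1)\<close>, expanding \<open>1 = \<Sum>\<lambda>\<^sub>c c\<close> shows that every coordinate of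
  \<open>\<Delta>(b)\<close> is a sum of some of the \<open>\<lambda>\<^sub>c\<close>.
\<close>

lemma tensor_eq_sum:
  assumes "\<And>i. i \<in> A \<Longrightarrow> tensor_eq s (f i) (g i)"
  shows "tensor_eq s (sum f A) (sum g A)"
  using assms
  by (induction A rule: infinite_finite_induct) (auto intro: tensor_eq_refl tensor_eq_add)

text \<open>The formal generator \<open>gen (x, 0)\<close> is nonzero in the free space; it vanishes
  only in the quotient, by the scaling relation with scalar 0.\<close>

lemma tensor_eq_gen_zero_right:
  assumes "vector_space s"
  shows "tensor_eq s (gen (x, 0)) 0"
proof -
  interpret vector_space s by fact
  show ?thesis
    using tensor_eq_relations(4)[of s x 0 0] by simp
qed

lemma tensor_eq_gen_sum_right:
  assumes "vector_space s"
  shows "tensor_eq s (gen (x, \<Sum>i\<in>A. s (a i) (g i))) (\<Sum>i\<in>A. fscale (a i) (gen (x, g i)))"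
proof (induction A rule: infinite_finite_induct)
  case (insert i A)
  have "tensor_eq s (gen (x, s (a i) (g i) + (\<Sum>i\<in>A. s (a i) (g i))))
      (fscale (a i) (gen (x, g i)) + (\<Sum>i\<in>A. fscale (a i) (gen (x, g i))))"
    by (rule tensor_eq_trans[OF tensor_eq_relations(2)
          tensor_eq_add[OF tensor_eq_relations(4) insert.IH]])
  with insert.hyps show ?case by simp
qed (simp_all add: tensor_eq_gen_zero_right[OF assms])

lemma lin_ext_lin_ext:
  assumes "vector_space s"
  shows "lin_ext s f (lin_ext fscale g u) = lin_ext s (\<lambda>i. lin_ext s f (g i)) u"
proof -
  interpret L: Vector_Spaces.linear fscale s "lin_ext s f"
    by (rule linear_lin_ext) fact
  show ?thesis
    by (simp add: lin_ext_def[of fscale] L.sum L.scale) (simp add: lin_ext_def)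
qed

text \<open>Since the expansion in \<open>B\<close> is unique, exhibiting one computes the definite
  description.\<close>

lemma tensor_coords_eqI:
  assumes "vector_space s" "is_basis s B"
    and "Poly_Mapping.keys a \<subseteq> B \<times> B" "tensor_eq s u a"
  shows "tensor_coords s B u = a"
  unfolding tensor_coords_def
  by (rule the1_equality[OF tensor_coords_ex1[OF assms(1,2)]]) (use assms(3,4) in blast)

lemma Phi_gen:
  "Phi comult (gen (x, y)) = lin_ext fscale (\<lambda>(p, q). gen (p, q * y)) (comult x)"
  unfolding Phi_def by (simp add: lin_ext_gen[OF free.vector_space_axioms])

text \<open>A literal equality of representatives: each term of \<open>comult x\<close> has its
  second factor multiplied by 1.\<close>

lemma Phi_gen_one: "Phi comult (gen (x, 1)) = comult x"
  by (simp add: Phi_gen lin_ext_fscale_gen case_prod_unfold)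

context complex_embedding
begin

lemma embed_zero: "\<sigma> 0 = 0"
  using embed_add[of 0 0] by simp

lemma nonneg_scalar_zero: "nonneg_scalar \<sigma> 0"
  by (simp add: nonneg_scalar_def embed_zero)

lemma nonneg_scalar_add:
  "nonneg_scalar \<sigma> a \<Longrightarrow> nonneg_scalar \<sigma> b \<Longrightarrow> nonneg_scalar \<sigma> (a + b)"
  by (simp add: nonneg_scalar_def embed_add nonneg_Reals_add_I)

lemma nonneg_scalar_sum:
  assumes "\<And>i. i \<in> A \<Longrightarrow> nonneg_scalar \<sigma> (f i)"
  shows "nonneg_scalar \<sigma> (sum f A)"
  using assms
  by (induction A rule: infinite_finite_induct)
    (auto intro: nonneg_scalar_zero nonneg_scalar_add)

end

context hopf_algebra
begin

text \<open>Only a congruence, because formal generators are not additive in their second entry. The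
  sum is pulled out of each term of \<open>comult x\<close> separately.\<close>

lemma Phi_gen_sum_right:
  "tensor_eq scale (Phi comult (gen (x, \<Sum>i\<in>A. scale (a i) (g i))))
     (\<Sum>i\<in>A. fscale (a i) (Phi comult (gen (x, g i))))"
proof -
  let ?c = "Poly_Mapping.lookup (comult x)" and ?K = "Poly_Mapping.keys (comult x)"
  have "tensor_eq scale (Phi comult (gen (x, \<Sum>i\<in>A. scale (a i) (g i))))
      (\<Sum>t\<in>?K. fscale (?c t) (\<Sum>i\<in>A. fscale (a i) (gen (fst t, snd t * g i))))"
    unfolding Phi_gen lin_ext_def split_beta
    by (intro tensor_eq_sum tensor_eq_scale)
      (simp add: sum_distrib_left mult_scale_right
        tensor_eq_gen_sum_right[OF vector_space_axioms])
  also have "(\<Sum>t\<in>?K. fscale (?c t) (\<Sum>i\<in>A. fscale (a i) (gen (fst t, snd t * g i)))) =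
      (\<Sum>i\<in>A. fscale (a i) (Phi comult (gen (x, g i))))"
    \<comment> \<open>Exchanging the two sums groups the terms of \<open>comult x\<close> into one
      copy of \<open>Phi\<close> for each \<open>i\<close>.\<close>
    unfolding Phi_gen lin_ext_def split_beta free.scale_sum_right
    by (subst sum.swap) (simp only: free.scale_scale mult.commute)
  finally show ?thesis .
qed

lemma mult_eq_counit_scale:
  assumes "tensor_eq scale (Phi comult (gen (b, c))) (gen (b', c'))"
  shows "b * c = scale (counit b') c'"
proof -
  interpret counit: Vector_Spaces.linear scale "(*)" counit
    by (rule linear_counit)
  let ?f = "\<lambda>(x, y). scale (counit x) y"
  have "lin_ext scale ?f (Phi comult (gen (b, c))) = lin_ext scale ?f (gen (b', c'))"
    \<comment> \<open>Bilinearity of \<open>?f\<close> lets it descend to tensor classes, so the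
      congruence becomes an equation in the algebra.\<close>
    by (rule tensor_eq_lin_ext[OF vector_space_axioms _ _ _ _ assms])
      (simp_all add: counit.add counit.scale scale_left_distrib scale_right_distrib mult.commute)
  also have "lin_ext scale ?f (Phi comult (gen (b, c))) =
      lin_ext scale (\<lambda>(p, q). scale (counit p) (q * c)) (comult b)"
    by (simp add: Phi_gen lin_ext_lin_ext[OF vector_space_axioms] case_prod_unfold
        lin_ext_gen[OF vector_space_axioms])
  \<comment> \<open>Right multiplication by \<open>c\<close> factors out; what remains is the left
    side of the counit axiom.\<close>
  also have "\<dots> = lin_ext scale ?f (comult b) * c"
    by (simp add: lin_ext_def sum_distrib_right split_beta mult_scale_left)
  finally show ?thesis
    by (simp add: counit_left lin_ext_gen[OF vector_space_axioms])
qed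

end

theorem corollary5p2:
  fixes \<sigma> :: "'k::field_char_0 \<Rightarrow> complex"
    and scale :: "'k \<Rightarrow> 'h::ring_1 \<Rightarrow> 'h"
    and comult :: "'h \<Rightarrow> (('h \<times> 'h) \<Rightarrow>\<^sub>0 'k)"
    and counit :: "'h \<Rightarrow> 'k"
    and antipode :: "'h \<Rightarrow> 'h"
    and \<B> :: "'h set"
  assumes "complex_embedding \<sigma>"
    and "hopf_algebra scale comult counit antipode"
    and "Phi_set_theoretic_basis scale comult \<B>"
    and "\<forall>b\<in>\<B>. nonneg_scalar \<sigma> (counit b)"
    and "\<forall>c\<in>\<B>. nonneg_scalar \<sigma> (module.representation scale \<B> 1 c)"
  shows "nearly_positive_basis_property \<sigma> scale comult counit"
proof -
  interpret complex_embedding \<sigma> by fact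
  interpret hopf_algebra scale comult counit antipode by fact
  have basis: "is_basis scale \<B>"
    and set_theoretic: "\<And>b c. b \<in> \<B> \<Longrightarrow> c \<in> \<B> \<Longrightarrow>
      \<exists>b'\<in>\<B>. \<exists>c'\<in>\<B>. tensor_eq scale (Phi comult (gen (b, c))) (gen (b', c'))"
    using assms(3) by (auto simp: Phi_set_theoretic_basis_def)
  have ind: "independent \<B>" and span: "\<And>x. x \<in> span \<B>"
    using basis by (auto simp: is_basis_def)
  have mult: "nonneg_scalar \<sigma> (representation \<B> (b1 * b2) c)"
    if b: "b1 \<in> \<B>" "b2 \<in> \<B>" for b1 b2 c
  proof -
    obtain b' c' where "b' \<in> \<B>" "c' \<in> \<B>"
      "tensor_eq scale (Phi comult (gen (b1, b2))) (gen (b', c'))"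
      using set_theoretic[OF b] by blast
    \<comment> \<open>The product is \<open>scale (counit b') c'\<close>, so its coordinate at
      \<open>c\<close> is \<open>counit b'\<close> if \<open>c = c'\<close> and 0 otherwise.\<close>
    then show ?thesis
      using assms(4)
      by (simp add: mult_eq_counit_scale representation_scale[OF ind span]
          representation_basis[OF ind] nonneg_scalar_zero)
  qed
  have comult: "nonneg_scalar \<sigma> (Poly_Mapping.lookup (tensor_coords scale \<B> (comult b)) i)"
    if "b \<in> \<B>" for b i
  proof -
    \<comment> \<open>The support of the unit, which turns its expansion into a sum over basis
      elements.\<close>
    define C where "C = {c. representation \<B> 1 c \<noteq> 0}"
    have C: "C \<subseteq> \<B>"
      by (auto simp: C_def dest: representation_ne_zero)
    have one: "(\<Sum>c\<in>C. scale (representation \<B> 1 c) c) = 1"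
      unfolding C_def by (rule sum_nonzero_representation_eq[OF ind span])
    have "\<forall>c\<in>C. \<exists>t\<in>\<B> \<times> \<B>. tensor_eq scale (Phi comult (gen (b, c))) (gen t)"
      using set_theoretic[OF that] C by fast
    then obtain t where t: "\<And>c. c \<in> C \<Longrightarrow> t c \<in> \<B> \<times> \<B>"
      "\<And>c. c \<in> C \<Longrightarrow> tensor_eq scale (Phi comult (gen (b, c))) (gen (t c))"
      by metis
    let ?a = "\<Sum>c\<in>C. fscale (representation \<B> 1 c) (gen (t c))"
    have "tensor_eq scale (comult b)
        (\<Sum>c\<in>C. fscale (representation \<B> 1 c) (Phi comult (gen (b, c))))"
      \<comment> \<open>With these coefficients the second tensor factor sums to 1, and
        \<open>Phi\<close> of \<open>gen (b, 1)\<close> is \<open>comult b\<close>.\<close>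
      using Phi_gen_sum_right[of b "representation \<B> 1" "\<lambda>c. c" C]
      by (simp only: one Phi_gen_one)
    then have "tensor_eq scale (comult b) ?a"
      by (rule tensor_eq_trans) (intro tensor_eq_sum tensor_eq_scale t(2))
    moreover have "Poly_Mapping.keys ?a \<subseteq> \<B> \<times> \<B>"
    proof
      fix j assume "j \<in> Poly_Mapping.keys ?a"
      \<comment> \<open>A nonzero coefficient at \<open>j\<close> forces some summand to be nonzero
        there, and each summand is supported at a single \<open>t c\<close>.\<close>
      then obtain c where "c \<in> C" "t c = j"
        by (auto simp: in_keys_iff lookup_sum lookup_single when_def
            elim!: sum.not_neutral_contains_not_neutral split: if_splits)
      with t(1) show "j \<in> \<B> \<times> \<B>" by blast
    qed
    ultimately have "tensor_coords scale \<B> (comult b) = ?a"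
      by (intro tensor_coords_eqI[OF vector_space_axioms basis])
    \<comment> \<open>The summand for \<open>c\<close> contributes the coordinate of 1 at
      \<open>c\<close> when \<open>t c = i\<close> and 0 otherwise.\<close>
    moreover have "nonneg_scalar \<sigma> (Poly_Mapping.lookup ?a i)"
      unfolding lookup_sum using C assms(5)
      by (intro nonneg_scalar_sum) (auto simp: lookup_single when_def nonneg_scalar_zero)
    ultimately show ?thesis by simp
  qed
  show ?thesis
    unfolding nearly_positive_basis_property_def
    using basis assms(4,5) mult comult by blast
qed

end
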